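(* Let $\mathcal{S}$ be a countable set, let $p:\mathcal{S}^2\to[0,1]$ be transition probabilities on $\mathcal{S}$ (i.e. $\sum_{y} p(x,y)=1$ for all $x\in\mathcal{S}$), and let $q:\mathcal{S}\to[0,1)$ be a function. Suppose that the annealed field is non-trapping, i.e. for some $x_0\in\mathcal{S}$, $\tilde{\pi}(x_0)<1$. Then there exists a subset $A\subseteq\mathcal{S}$ such that (i) $A$ is transient for $x_0$, and (ii) $\sum_{x\in\mathcal{S}\setminus A} g(x_0,x)\,q(x)<\infty$.
   Context: For $x\in\mathcal{S}$, $\mathbf{P}_x$ denotes a probability measure under which $X_0,X_1,X_2,\ldots$ is a Markov chain with transition probabilities $p(\cdot,\cdot)$ started from $X_0=x$. The Greens function is $g(x,y)=\sum_{n=0}^\infty \mathbf{P}_x(X_n=y)$. Annealed problem: $(T_n)_{n\ge 0}$ is an i.i.d. sequence of random subsets of $\mathcal{S}$, independent of the chain, where each $T_n$ contains each site $x\in\mathcal{S}$ independently with probability $q(x)$. Put $\tilde{\pi}(x)=\mathbf{P}_x(X_n\in T_n\text{ for some }n\ge 0)$. The annealed field is called trapping if $\tilde{\pi}(x)=1$ for all $x\in\mathcal{S}$, and non-trapping if $\tilde{\pi}(x)<1$ for some $x$. A subset $A\subseteq\mathcal{S}$ is called transient for $x$ if $\mathbf{P}_x(X_n\in A\text{ for some }n\ge 0)<1$. *)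

theory Defs
  imports "HOL-Probability.Probability"
begin

definition transition_probabilities :: "('s \<Rightarrow> 's \<Rightarrow> real) \<Rightarrow> bool" where
  "transition_probabilities p \<longleftrightarrow>
     (\<forall>x y. 0 \<le> p x y \<and> p x y \<le> 1) \<and> (\<forall>x. (p x has_sum 1) UNIV)"

definition markov_chain ::
  "'w measure \<Rightarrow> (nat \<Rightarrow> 'w \<Rightarrow> 's::countable) \<Rightarrow> ('s \<Rightarrow> 's \<Rightarrow> real) \<Rightarrow> 's \<Rightarrow> bool" where
  "markov_chain M X p x \<longleftrightarrow>
     prob_space M \<and>
     (\<forall>n. X n \<in> measurable M (count_space UNIV)) \<and>
     (AE \<omega> in M. X 0 \<omega> = x) \<and>
     (\<forall>n s y. 0 < \<P>(\<omega> in M. \<forall>i\<le>n. X i \<omega> = s i) \<longrightarrow>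
        \<P>(\<omega> in M. X (Suc n) \<omega> = y \<bar> \<forall>i\<le>n. X i \<omega> = s i) = p (s n) y)"

text \<open>The state space of a random subset: the product sigma-algebra on subsets of \<open>'s\<close>,
  i.e. the one generated by the events that a given site belongs to the set.\<close>

definition subset_space :: "'s set measure" where
  "subset_space = sigma UNIV (range (\<lambda>x. {A. x \<in> A}))"

text \<open>The independence from the chain is expressed by generated sigma-algebras, since
  \<^const>\<open>prob_space.indep_var\<close> requires both random variables to have the same value type.\<close>

definition annealed_field ::
  "'w measure \<Rightarrow> (nat \<Rightarrow> 'w \<Rightarrow> 's::countable) \<Rightarrow> (nat \<Rightarrow> 'w \<Rightarrow> 's set) \<Rightarrow> ('s \<Rightarrow> real) \<Rightarrow> bool" where
  "annealed_field M X T q \<longleftrightarrow>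
     prob_space.indep_vars M (\<lambda>_. subset_space) T UNIV \<and>
     (\<forall>m n. distr M subset_space (T m) = distr M subset_space (T n)) \<and>
     (\<forall>n. prob_space.indep_events M (\<lambda>x. {\<omega> \<in> space M. x \<in> T n \<omega>}) UNIV) \<and>
     (\<forall>n x. \<P>(\<omega> in M. x \<in> T n \<omega>) = q x) \<and>
     prob_space.indep_set M
       (sets (vimage_algebra (space M) (\<lambda>\<omega> n. X n \<omega>) (\<Pi>\<^sub>M n\<in>UNIV. count_space UNIV)))
       (sets (vimage_algebra (space M) (\<lambda>\<omega> n. T n \<omega>) (\<Pi>\<^sub>M n\<in>UNIV. subset_space)))"

definition greens :: "('s \<Rightarrow> 'w measure) \<Rightarrow> (nat \<Rightarrow> 'w \<Rightarrow> 's) \<Rightarrow> 's \<Rightarrow> 's \<Rightarrow> ennreal" where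
  "greens P X x y = (\<Sum>n. ennreal (\<P>(\<omega> in P x. X n \<omega> = y)))"

definition trap_prob ::
  "('s \<Rightarrow> 'w measure) \<Rightarrow> (nat \<Rightarrow> 'w \<Rightarrow> 's) \<Rightarrow> (nat \<Rightarrow> 'w \<Rightarrow> 's set) \<Rightarrow> 's \<Rightarrow> real" where
  "trap_prob P X T x = \<P>(\<omega> in P x. \<exists>n. X n \<omega> \<in> T n \<omega>)"

definition transient_for ::
  "('s \<Rightarrow> 'w measure) \<Rightarrow> (nat \<Rightarrow> 'w \<Rightarrow> 's) \<Rightarrow> 's set \<Rightarrow> 's \<Rightarrow> bool" where
  "transient_for P X A x \<longleftrightarrow> \<P>(\<omega> in P x. \<exists>n. X n \<omega> \<in> A) < 1"

end

theory Submission imports Defs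
begin

text \<open>
  Let \<open>h x\<close> be the probability that the chain from \<open>x\<close> never meets a trap; \<open>h x0 > 0\<close> since the
  field is non-trapping. To survive from \<open>x\<close>, one must survive the trap at \<open>x\<close>, make a step and
  survive from there, so \<open>h = (1 - q) (p h)\<close>, where \<open>p h\<close> is the one-step average of \<open>h\<close>
  (\<open>killed_op_survival\<close>). Hence \<open>p h = h + q (p h) \<ge> h + q h\<close> (\<open>survival_drift\<close>): the function \<open>h\<close>
  is subharmonic, with a drift of at least \<open>q h\<close>, and it is bounded by 1.

  The set is \<open>A = {h \<le> h x0 / 2}\<close>. Stop the chain when it enters \<open>A\<close>. The stopped
  process \<open>h (X n)\<close> is a submartingale that starts at \<open>h x0\<close>, is at most \<open>h x0 / 2\<close> once stopped, and is at
  most 1 before. So \<open>A\<close> is missed with probability at least \<open>h x0 / 2\<close>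
  (\<open>subharmonic_le_escape\<close>). On the other hand, the expectation of \<open>h (X n)\<close> stays in \<open>[0, 1]\<close> and
  increases in step \<open>n\<close> by at least that of \<open>(q h) (X n)\<close>, so the sum of the latter over all
  \<open>n\<close> is at most 1 (\<open>drift_sum_le\<close>). Outside \<open>A\<close> the factor \<open>h\<close> is at least \<open>h x0 / 2\<close>, which
  bounds the sum of \<open>g(x0, x) q(x)\<close> over \<open>x \<notin> A\<close> by \<open>2 / h x0\<close>.

  The function \<open>h\<close> is introduced analytically, as the limit of the iterates of
  \<open>f \<mapsto> (1 - q) (p f)\<close> on the constant 1, so that only the chain started at \<open>x0\<close> enters the argument.
  Its probabilistic meaning is recovered by conditioning on the finite paths, of which there are
  countably many (\<open>emeasure_no_trap\<close>).
\<close>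

section \<open>Transition operator and survival function\<close>

definition transition_op :: "('s \<Rightarrow> 's \<Rightarrow> real) \<Rightarrow> ('s \<Rightarrow> ennreal) \<Rightarrow> 's \<Rightarrow> ennreal" where
  "transition_op p f x = (\<integral>\<^sup>+ y. ennreal (p x y) * f y \<partial>count_space UNIV)"

text \<open>One step of the chain that is first exposed to a trap at its current site.\<close>

definition killed_op ::
  "('s \<Rightarrow> 's \<Rightarrow> real) \<Rightarrow> ('s \<Rightarrow> real) \<Rightarrow> ('s \<Rightarrow> ennreal) \<Rightarrow> 's \<Rightarrow> ennreal" where
  "killed_op p q f x = ennreal (1 - q x) * transition_op p f x"

definition survival :: "('s \<Rightarrow> 's \<Rightarrow> real) \<Rightarrow> ('s \<Rightarrow> real) \<Rightarrow> 's \<Rightarrow> ennreal" where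
  "survival p q x = (INF n. (killed_op p q ^^ n) (\<lambda>_. 1) x)"

lemma transition_op_mono: "f \<le> g \<Longrightarrow> transition_op p f \<le> transition_op p g"
  unfolding transition_op_def le_fun_def by (auto intro!: nn_integral_mono mult_left_mono)

lemma killed_op_mono: "f \<le> g \<Longrightarrow> killed_op p q f \<le> killed_op p q g"
  using transition_op_mono[of f g p] unfolding killed_op_def le_fun_def by (auto intro!: mult_left_mono)

lemma transition_op_const_1:
  assumes "transition_probabilities p"
  shows "transition_op p (\<lambda>_. 1) x = 1"
proof -
  have nonneg: "\<And>y. 0 \<le> p x y" and sum: "(p x has_sum 1) UNIV"
    using assms by (auto simp: transition_probabilities_def)
  have "(\<lambda>y. norm (p x y)) summable_on UNIV"
    using sum nonneg by (auto simp: summable_on_def)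
  then have abs: "Infinite_Set_Sum.abs_summable_on (p x) UNIV"
    by (simp flip: abs_summable_equivalent)
  then have "integrable (count_space UNIV) (p x)"
    by (simp add: Infinite_Set_Sum.abs_summable_on_def)
  moreover have "integral\<^sup>L (count_space UNIV) (p x) = 1"
    using infsetsum_infsum[OF abs] sum by (simp add: infsetsum_def infsumI)
  ultimately show ?thesis
    using nonneg by (simp add: transition_op_def nn_integral_eq_integral)
qed

lemma killed_op_const_1_le:
  assumes "transition_probabilities p" "\<And>x. 0 \<le> q x"
  shows "killed_op p q (\<lambda>_. 1) \<le> (\<lambda>_. 1)"
  using assms(2) by (auto simp: killed_op_def transition_op_const_1[OF assms(1)] le_fun_def)

lemma decseq_killed_op_power:
  assumes "transition_probabilities p" "\<And>x. 0 \<le> q x"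
  shows "decseq (\<lambda>n. (killed_op p q ^^ n) (\<lambda>_. 1))"
proof (rule decseq_SucI)
  fix n
  show "(killed_op p q ^^ Suc n) (\<lambda>_. 1) \<le> (killed_op p q ^^ n) (\<lambda>_. 1)"
  proof (induction n)
    case 0
    then show ?case using killed_op_const_1_le[OF assms] by simp
  next
    case (Suc n)
    then show ?case using killed_op_mono by fastforce
  qed
qed

lemma survival_le_1: "survival p q x \<le> 1"
  unfolding survival_def by (rule INF_lower2[of 0]) auto

text \<open>
  The operator commutes with the decreasing limit of its iterates because the integrals are
  dominated by the total transition probability 1.
\<close>

lemma killed_op_survival:
  assumes p: "transition_probabilities p" and q: "\<And>x. 0 \<le> q x"
  shows "killed_op p q (survival p q) = survival p q"
proof
  fix x
  let ?h = "\<lambda>n. (killed_op p q ^^ n) (\<lambda>_. 1)"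
  note dec = decseq_killed_op_power[OF assms]
  have "transition_op p (survival p q) x
      = (\<integral>\<^sup>+ y. (INF n. ennreal (p x y) * ?h n y) \<partial>count_space UNIV)"
    unfolding transition_op_def
  proof (rule nn_integral_cong)
    fix y
    have "(\<lambda>n. ennreal (p x y) * ?h n y) \<longlonglongrightarrow> ennreal (p x y) * survival p q y"
      unfolding survival_def
      by (intro ennreal_tendsto_cmult LIMSEQ_INF) (use dec in \<open>auto simp: monotone_def le_fun_def\<close>)
    moreover have "(\<lambda>n. ennreal (p x y) * ?h n y) \<longlonglongrightarrow> (INF n. ennreal (p x y) * ?h n y)"
      by (intro LIMSEQ_INF) (use dec in \<open>auto simp: monotone_def le_fun_def intro!: mult_left_mono\<close>)
    ultimately show "ennreal (p x y) * survival p q y = (INF n. ennreal (p x y) * ?h n y)"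
      using LIMSEQ_unique by blast
  qed
  also have "\<dots> = (INF n. transition_op p (?h n) x)"
    unfolding transition_op_def
  proof (rule nn_integral_monotone_convergence_INF_decseq[where i = 0])
    show "decseq (\<lambda>n y. ennreal (p x y) * ?h n y)"
      using dec by (auto simp: monotone_def le_fun_def intro!: mult_left_mono)
    show "(\<integral>\<^sup>+ y. ennreal (p x y) * ?h 0 y \<partial>count_space UNIV) < \<infinity>"
      using transition_op_const_1[OF p, of x] by (simp add: transition_op_def)
  qed auto
  finally have eq: "transition_op p (survival p q) x = (INF n. transition_op p (?h n) x)" .
  have "decseq (\<lambda>n. transition_op p (?h n) x)"
    using dec transition_op_mono[of _ _ p] by (auto simp: monotone_def le_fun_def)
  then have "(\<lambda>n. ?h (Suc n) x) \<longlonglongrightarrow> killed_op p q (survival p q) x"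
    by (auto simp: killed_op_def eq intro!: ennreal_tendsto_cmult LIMSEQ_INF)
  moreover have "(\<lambda>n. ?h (Suc n) x) \<longlonglongrightarrow> survival p q x"
    unfolding survival_def
    by (intro LIMSEQ_Suc LIMSEQ_INF) (use dec in \<open>auto simp: monotone_def le_fun_def\<close>)
  ultimately show "killed_op p q (survival p q) x = survival p q x"
    using LIMSEQ_unique by blast
qed

text \<open>
  Write the fixed point equation as \<open>p h = (1 - q) (p h) + q (p h) = h + q (p h)\<close>, and bound
  \<open>p h\<close> below by \<open>h\<close> in the last term.
\<close>

lemma survival_drift:
  assumes p: "transition_probabilities p" and q: "\<And>x. 0 \<le> q x \<and> q x \<le> 1"
  shows "survival p q x + ennreal (q x) * survival p q x \<le> transition_op p (survival p q) x"
proof -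
  let ?h = "survival p q"
  have fix_h: "ennreal (1 - q x) * transition_op p ?h x = ?h x"
    using killed_op_survival[OF p] q by (metis killed_op_def)
  have "?h x \<le> transition_op p ?h x"
    using q[of x] mult_right_mono[of "ennreal (1 - q x)" 1 "transition_op p ?h x"]
    by (simp add: fix_h)
  then have "?h x + ennreal (q x) * ?h x
      \<le> ennreal (1 - q x) * transition_op p ?h x + ennreal (q x) * transition_op p ?h x"
    unfolding fix_h by (intro add_mono mult_left_mono) auto
  also have "\<dots> = transition_op p ?h x"
    using q[of x] by (simp flip: distrib_right ennreal_plus)
  finally show ?thesis .
qed

section \<open>The Markov property on finite paths\<close>

text \<open>
  Conditioning on the value of a discrete random variable: on \<open>{Z = z}\<close>, the random parameter of
  \<open>H\<close> may be replaced by the constant \<open>z\<close>.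
\<close>

lemma nn_integral_split_countable:
  fixes Z :: "'w \<Rightarrow> 'b::countable" and H :: "'b \<Rightarrow> 'w \<Rightarrow> ennreal"
  assumes [measurable]: "Z \<in> measurable M (count_space UNIV)" "\<And>z. H z \<in> borel_measurable M"
  shows "(\<integral>\<^sup>+ \<omega>. H (Z \<omega>) \<omega> \<partial>M)
       = (\<integral>\<^sup>+ z. (\<integral>\<^sup>+ \<omega>. H z \<omega> * indicator {\<omega> \<in> space M. Z \<omega> = z} \<omega> \<partial>M) \<partial>count_space UNIV)"
proof -
  have "(\<integral>\<^sup>+ \<omega>. H (Z \<omega>) \<omega> \<partial>M)
      = (\<integral>\<^sup>+ \<omega>. (\<integral>\<^sup>+ z. H z \<omega> * indicator {\<omega> \<in> space M. Z \<omega> = z} \<omega> \<partial>count_space UNIV) \<partial>M)"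
  proof (rule nn_integral_cong)
    fix \<omega> assume "\<omega> \<in> space M"
    then have "(\<integral>\<^sup>+ z. H z \<omega> * indicator {\<omega> \<in> space M. Z \<omega> = z} \<omega> \<partial>count_space UNIV)
        = (\<integral>\<^sup>+ z. H z \<omega> * indicator {Z \<omega>} z \<partial>count_space UNIV)"
      by (intro nn_integral_cong) (auto split: split_indicator)
    then show "H (Z \<omega>) \<omega>
        = (\<integral>\<^sup>+ z. H z \<omega> * indicator {\<omega> \<in> space M. Z \<omega> = z} \<omega> \<partial>count_space UNIV)"
      by simp
  qed
  also have "\<dots> = (\<integral>\<^sup>+ z. (\<integral>\<^sup>+ \<omega>. H z \<omega> * indicator {\<omega> \<in> space M. Z \<omega> = z} \<omega> \<partial>M) \<partial>count_space UNIV)"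
    by (rule nn_integral_count_space_nn_integral) auto
  finally show ?thesis .
qed

lemma nn_integral_countable:
  fixes Z :: "'w \<Rightarrow> 'b::countable" and F :: "'b \<Rightarrow> ennreal"
  assumes [measurable]: "Z \<in> measurable M (count_space UNIV)"
  shows "(\<integral>\<^sup>+ \<omega>. F (Z \<omega>) \<partial>M)
       = (\<integral>\<^sup>+ z. F z * emeasure M {\<omega> \<in> space M. Z \<omega> = z} \<partial>count_space UNIV)"
  by (subst nn_integral_split_countable[where H = "\<lambda>z _. F z"]) (auto simp: nn_integral_cmult)

text \<open>
  Paths are lists, so that they range over a countable type and events about \<open>X 0, \<dots>, X n\<close> split
  into countably many cases.
\<close>

definition trajectory :: "(nat \<Rightarrow> 'w \<Rightarrow> 's) \<Rightarrow> nat \<Rightarrow> 'w \<Rightarrow> 's list" where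
  "trajectory X n \<omega> = map (\<lambda>i. X i \<omega>) [0..<Suc n]"

lemma length_trajectory [simp]: "length (trajectory X n \<omega>) = Suc n"
  by (simp add: trajectory_def)

lemma nth_trajectory [simp]: "k \<le> n \<Longrightarrow> trajectory X n \<omega> ! k = X k \<omega>"
  by (simp add: trajectory_def del: upt_Suc)

lemma trajectory_eq_iff: "length l = Suc n \<Longrightarrow> trajectory X n \<omega> = l \<longleftrightarrow> (\<forall>i\<le>n. X i \<omega> = l ! i)"
  by (auto simp: list_eq_iff_nth_eq less_Suc_eq_le)

lemma measurable_trajectory:
  fixes X :: "nat \<Rightarrow> 'w \<Rightarrow> 's::countable"
  assumes [measurable]: "\<And>n. X n \<in> measurable M (count_space UNIV)"
  shows "trajectory X n \<in> measurable M (count_space UNIV)"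
proof (subst measurable_count_space_eq2_countable, intro conjI ballI)
  fix l :: "'s list"
  show "trajectory X n -` {l} \<inter> space M \<in> sets M"
  proof (cases "length l = Suc n")
    case True
    then have "trajectory X n -` {l} \<inter> space M = {\<omega> \<in> space M. \<forall>i\<le>n. X i \<omega> = l ! i}"
      using trajectory_eq_iff[OF True, of X] by auto
    then show ?thesis by simp
  next
    case False
    then have "trajectory X n -` {l} = {}" using length_trajectory by auto
    then show ?thesis by simp
  qed
qed auto

text \<open>
  The defining property of a Markov chain as a product formula, which also covers the
  paths of probability 0.
\<close>

lemma markov_chain_path_step:
  assumes mc: "markov_chain M X p x" and l: "length l = Suc n"
  shows "measure M {\<omega> \<in> space M. trajectory X n \<omega> = l \<and> X (Suc n) \<omega> = y}
       = measure M {\<omega> \<in> space M. trajectory X n \<omega> = l} * p (l ! n) y"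
proof -
  interpret prob_space M using mc by (simp add: markov_chain_def)
  have [measurable]: "\<And>n. X n \<in> measurable M (count_space UNIV)"
    using mc by (simp add: markov_chain_def)
  note [measurable] = measurable_trajectory[of X M]
  let ?A = "{\<omega> \<in> space M. trajectory X n \<omega> = l}"
  let ?B = "{\<omega> \<in> space M. trajectory X n \<omega> = l \<and> X (Suc n) \<omega> = y}"
  show ?thesis
  proof (cases "measure M ?A = 0")
    case True
    moreover have "measure M ?B \<le> measure M ?A"
      by (intro finite_measure_mono) auto
    ultimately show ?thesis
      using measure_nonneg[of M ?B] by simp
  next
    case False
    then have "0 < measure M ?A"
      using measure_nonneg[of M ?A] by linarith
    then have "\<P>(\<omega> in M. X (Suc n) \<omega> = y \<bar> \<forall>i\<le>n. X i \<omega> = l ! i) = p (l ! n) y"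
      using mc by (simp add: markov_chain_def trajectory_eq_iff[OF l])
    then show ?thesis
      using False by (simp add: cond_prob_def trajectory_eq_iff[OF l] conj_commute field_simps)
  qed
qed

text \<open>
  The Markov property in the form \<open>E[G f(X (n + 1))] = E[G (p f)(X n)]\<close> for every \<open>G\<close> that depends
  on the first \<open>n + 1\<close> positions only.
\<close>

lemma nn_integral_markov_step:
  fixes X :: "nat \<Rightarrow> 'w \<Rightarrow> 's::countable" and G :: "'s list \<Rightarrow> ennreal" and f :: "'s \<Rightarrow> ennreal"
  assumes mc: "markov_chain M X p x" and p: "transition_probabilities p"
  shows "(\<integral>\<^sup>+ \<omega>. G (trajectory X n \<omega>) * f (X (Suc n) \<omega>) \<partial>M)
       = (\<integral>\<^sup>+ \<omega>. G (trajectory X n \<omega>) * transition_op p f (X n \<omega>) \<partial>M)"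
proof -
  interpret prob_space M using mc by (simp add: markov_chain_def)
  have [measurable]: "\<And>n. X n \<in> measurable M (count_space UNIV)"
    using mc by (simp add: markov_chain_def)
  note [measurable] = measurable_trajectory[of X M]
  let ?Z = "\<lambda>\<omega>. (trajectory X n \<omega>, X (Suc n) \<omega>)"
  have Z: "?Z \<in> measurable M (count_space UNIV)"
    by (subst pair_measure_countable[symmetric, of UNIV UNIV, simplified]) auto
  have *: "emeasure M {\<omega> \<in> space M. ?Z \<omega> = (l, y)}
      = emeasure M {\<omega> \<in> space M. trajectory X n \<omega> = l} * ennreal (p (l ! n) y)" for l y
  proof (cases "length l = Suc n")
    case True
    then show ?thesis
      using markov_chain_path_step[OF mc True, of y] p
      by (simp add: emeasure_eq_measure transition_probabilities_def ennreal_mult)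
  next
    case False
    then have "\<And>\<omega>. trajectory X n \<omega> \<noteq> l" using length_trajectory by metis
    then show ?thesis by simp
  qed
  have "(\<integral>\<^sup>+ \<omega>. G (trajectory X n \<omega>) * f (X (Suc n) \<omega>) \<partial>M)
      = (\<integral>\<^sup>+ z. G (fst z) * f (snd z) * emeasure M {\<omega> \<in> space M. ?Z \<omega> = z} \<partial>count_space UNIV)"
    using nn_integral_countable[OF Z, of "\<lambda>z. G (fst z) * f (snd z)"] by simp
  also have "\<dots> = (\<integral>\<^sup>+ l. \<integral>\<^sup>+ y. G l * f y
      * (emeasure M {\<omega> \<in> space M. trajectory X n \<omega> = l} * ennreal (p (l ! n) y)) \<partial>count_space UNIV \<partial>count_space UNIV)"
    by (subst nn_integral_fst_count_space[symmetric]) (simp only: fst_conv snd_conv *)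
  also have "\<dots> = (\<integral>\<^sup>+ l. G l * transition_op p f (l ! n)
      * emeasure M {\<omega> \<in> space M. trajectory X n \<omega> = l} \<partial>count_space UNIV)"
    unfolding transition_op_def
    by (intro nn_integral_cong)
      (simp add: nn_integral_cmult[symmetric] nn_integral_multc[symmetric] mult_ac)
  also have "\<dots> = (\<integral>\<^sup>+ \<omega>. G (trajectory X n \<omega>) * transition_op p f (trajectory X n \<omega> ! n) \<partial>M)"
    by (rule nn_integral_countable[symmetric]) measurable
  finally show ?thesis by simp
qed

lemma nn_integral_start:
  assumes mc: "markov_chain M X p x"
  shows "(\<integral>\<^sup>+ \<omega>. f (X 0 \<omega>) \<partial>M) = f x"
proof -
  interpret prob_space M using mc by (simp add: markov_chain_def)
  have "(\<integral>\<^sup>+ \<omega>. f (X 0 \<omega>) \<partial>M) = (\<integral>\<^sup>+ \<omega>. f x \<partial>M)"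
    using mc by (intro nn_integral_cong_AE) (auto simp: markov_chain_def)
  then show ?thesis by (simp add: emeasure_space_1)
qed

section \<open>Survival among the traps\<close>

text \<open>
  A Feynman-Kac formula. The induction generalizes over \<open>f\<close>: the last step of the chain
  and the factor at time \<open>n\<close> are absorbed into \<open>f\<close>.
\<close>

lemma nn_integral_killed_op_power:
  fixes X :: "nat \<Rightarrow> 'w \<Rightarrow> 's::countable"
  assumes mc: "markov_chain M X p x" and p: "transition_probabilities p"
  shows "(\<integral>\<^sup>+ \<omega>. (\<Prod>k<n. ennreal (1 - q (X k \<omega>))) * f (X n \<omega>) \<partial>M) = (killed_op p q ^^ n) f x"
proof (induction n arbitrary: f)
  case 0
  then show ?case using nn_integral_start[OF mc] by simp
next
  case (Suc n)
  have "(\<integral>\<^sup>+ \<omega>. (\<Prod>k<Suc n. ennreal (1 - q (X k \<omega>))) * f (X (Suc n) \<omega>) \<partial>M)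
      = (\<integral>\<^sup>+ \<omega>. (\<Prod>k<Suc n. ennreal (1 - q (X k \<omega>))) * transition_op p f (X n \<omega>) \<partial>M)"
    using nn_integral_markov_step[OF mc p, of "\<lambda>l. \<Prod>k<Suc n. ennreal (1 - q (l ! k))" n f]
    by simp
  also have "\<dots> = (\<integral>\<^sup>+ \<omega>. (\<Prod>k<n. ennreal (1 - q (X k \<omega>))) * killed_op p q f (X n \<omega>) \<partial>M)"
    by (simp add: killed_op_def mult_ac)
  also have "\<dots> = (killed_op p q ^^ n) (killed_op p q f) x"
    by (rule Suc.IH)
  finally show ?case by (simp add: funpow_swap1)
qed

lemma measurable_annealed_field:
  assumes "prob_space M" "annealed_field M X T q"
  shows "{\<omega> \<in> space M. y \<in> T n \<omega>} \<in> sets M"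
proof -
  interpret prob_space M by fact
  have "T n \<in> measurable M subset_space"
    using assms(2) by (auto simp: annealed_field_def indep_vars_def)
  moreover have "{A. y \<in> A} \<in> sets subset_space"
    by (auto simp: subset_space_def)
  ultimately have "T n -` {A. y \<in> A} \<inter> space M \<in> sets M"
    by (rule measurable_sets)
  then show ?thesis
    by (simp add: vimage_def Int_def conj_commute)
qed

text \<open>
  Given the path, avoiding the traps is an event about the trap sets at fixed sites. It is
  independent of the chain, and the traps at different times are independent of each other.
\<close>

lemma prob_path_and_no_trap:
  fixes X :: "nat \<Rightarrow> 'w \<Rightarrow> 's::countable"
  assumes mc: "markov_chain M X p x" and field: "annealed_field M X T q"
    and l: "length l = Suc n"
  shows "measure M {\<omega> \<in> space M. trajectory X n \<omega> = l \<and> (\<forall>k<n. l ! k \<notin> T k \<omega>)}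
       = measure M {\<omega> \<in> space M. trajectory X n \<omega> = l} * (\<Prod>k<n. 1 - q (l ! k))"
proof -
  interpret prob_space M using mc by (simp add: markov_chain_def)
  note [measurable] = measurable_annealed_field[OF prob_space_axioms field]
  have avoid_space: "{A. y \<notin> A} \<in> sets subset_space" for y :: 's
  proof -
    have "space subset_space - {A. y \<in> A} \<in> sets subset_space"
      by (intro sets.compl_sets) (auto simp: subset_space_def)
    moreover have "space subset_space - {A. y \<in> A} = {A. y \<notin> A}"
      by (auto simp: subset_space_def space_measure_of_conv)
    ultimately show ?thesis by simp
  qed
  have space_subset: "space subset_space = (UNIV :: 's set set)"
    by (simp add: subset_space_def space_measure_of_conv)
  have sets_Collect_component: "{t \<in> space (\<Pi>\<^sub>M n\<in>(UNIV::nat set). subset_space). t k \<in> {A. y \<notin> A}}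
      \<in> sets (\<Pi>\<^sub>M n\<in>(UNIV::nat set). subset_space)" for k and y :: 's
  proof -
    have "(\<lambda>t. t k) \<in> measurable (\<Pi>\<^sub>M n\<in>(UNIV::nat set). (subset_space :: 's set measure)) subset_space"
      by (rule measurable_component_singleton) simp
    from measurable_sets[OF this avoid_space[of y]] show ?thesis
      by (simp add: vimage_def Int_def conj_commute)
  qed
  define E where "E = {s :: nat \<Rightarrow> 's. \<forall>i\<le>n. s i = l ! i}"
  define F where "F = {t :: nat \<Rightarrow> 's set. \<forall>k<n. l ! k \<notin> t k}"
  have "E = {s \<in> space (\<Pi>\<^sub>M n\<in>(UNIV::nat set). count_space (UNIV::'s set)). \<forall>i\<in>{..n}. s i \<in> {l ! i}}"
    by (auto simp: E_def space_PiM)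
  also have "\<dots> \<in> sets (\<Pi>\<^sub>M n\<in>(UNIV::nat set). count_space (UNIV::'s set))"
    by measurable
  finally have E: "E \<in> sets (\<Pi>\<^sub>M n\<in>(UNIV::nat set). count_space (UNIV::'s set))" .
  have "F = {t \<in> space (\<Pi>\<^sub>M n\<in>(UNIV::nat set). subset_space). \<forall>k\<in>{..<n}. t k \<in> {A. l ! k \<notin> A}}"
    by (auto simp: F_def space_PiM space_subset)
  also have "\<dots> \<in> sets (\<Pi>\<^sub>M n\<in>(UNIV::nat set). subset_space)"
    by (intro sets.sets_Collect_finite_All sets_Collect_component) auto
  finally have F: "F \<in> sets (\<Pi>\<^sub>M n\<in>(UNIV::nat set). (subset_space :: 's set measure))" .
  let ?F = "(\<lambda>\<omega> n. T n \<omega>) -` F \<inter> space M"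
  have "prob (((\<lambda>\<omega> n. X n \<omega>) -` E \<inter> space M) \<inter> ?F)
      = prob ((\<lambda>\<omega> n. X n \<omega>) -` E \<inter> space M) * prob ?F"
    using field in_vimage_algebra[OF E] in_vimage_algebra[OF F]
    by (intro indep_setD) (auto simp: annealed_field_def)
  moreover have "(\<lambda>\<omega> n. X n \<omega>) -` E \<inter> space M = {\<omega> \<in> space M. trajectory X n \<omega> = l}"
    by (auto simp: E_def trajectory_eq_iff[OF l])
  moreover have "{\<omega> \<in> space M. trajectory X n \<omega> = l} \<inter> ?F
      = {\<omega> \<in> space M. trajectory X n \<omega> = l \<and> (\<forall>k<n. l ! k \<notin> T k \<omega>)}"
    by (auto simp: F_def)
  moreover have "prob ?F = (\<Prod>k<n. 1 - q (l ! k))"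
  proof (cases "n = 0")
    case True
    then show ?thesis by (simp add: F_def prob_space)
  next
    case False
    have "?F = (\<Inter>k\<in>{..<n}. T k -` {A. l ! k \<notin> A} \<inter> space M)"
      using False by (auto simp: F_def)
    also have "prob \<dots> = (\<Prod>k<n. prob (T k -` {A. l ! k \<notin> A} \<inter> space M))"
      using False field avoid_space
      by (intro indep_varsD[where I = UNIV and M' = "\<lambda>_. subset_space"])
        (auto simp: annealed_field_def)
    also have "\<dots> = (\<Prod>k<n. 1 - q (l ! k))"
    proof (rule prod.cong[OF refl])
      fix k
      have "T k -` {A. l ! k \<notin> A} \<inter> space M = space M - {\<omega> \<in> space M. l ! k \<in> T k \<omega>}"
        by auto
      moreover have "prob (space M - {\<omega> \<in> space M. l ! k \<in> T k \<omega>})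
          = 1 - prob {\<omega> \<in> space M. l ! k \<in> T k \<omega>}"
        by (intro prob_compl) measurable
      ultimately show "prob (T k -` {A. l ! k \<notin> A} \<inter> space M) = 1 - q (l ! k)"
        using field by (simp add: annealed_field_def)
    qed
    finally show ?thesis .
  qed
  ultimately show ?thesis by simp
qed

lemma emeasure_no_trap:
  fixes X :: "nat \<Rightarrow> 'w \<Rightarrow> 's::countable"
  assumes mc: "markov_chain M X p x" and field: "annealed_field M X T q"
    and p: "transition_probabilities p" and q: "\<And>x. q x \<le> 1"
  shows "emeasure M {\<omega> \<in> space M. \<forall>k<n. X k \<omega> \<notin> T k \<omega>} = (killed_op p q ^^ n) (\<lambda>_. 1) x"
proof -
  interpret prob_space M using mc by (simp add: markov_chain_def)
  have [measurable]: "\<And>n. X n \<in> measurable M (count_space UNIV)"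
    using mc by (simp add: markov_chain_def)
  note [measurable] = measurable_trajectory[of X M] measurable_annealed_field[OF prob_space_axioms field]
  let ?H = "\<lambda>l. indicator {\<omega> \<in> space M. \<forall>k<n. l ! k \<notin> T k \<omega>} :: _ \<Rightarrow> ennreal"
  let ?W = "\<lambda>l. \<Prod>k<n. ennreal (1 - q (l ! k))"
  have hit: "{\<omega> \<in> space M. X k \<omega> \<in> T k \<omega>} \<in> sets M" for k
  proof -
    have "{\<omega> \<in> space M. X k \<omega> \<in> T k \<omega>} = {\<omega> \<in> space M. \<exists>y. X k \<omega> = y \<and> y \<in> T k \<omega>}"
      by auto
    also have "\<dots> \<in> sets M"
      by measurable
    finally show ?thesis .
  qed
  have slice: "(\<integral>\<^sup>+ \<omega>. ?H l \<omega> * indicator {\<omega> \<in> space M. trajectory X n \<omega> = l} \<omega> \<partial>M)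
      = ?W l * emeasure M {\<omega> \<in> space M. trajectory X n \<omega> = l}" for l
  proof (cases "length l = Suc n")
    case True
    have "(\<integral>\<^sup>+ \<omega>. ?H l \<omega> * indicator {\<omega> \<in> space M. trajectory X n \<omega> = l} \<omega> \<partial>M)
        = (\<integral>\<^sup>+ \<omega>. indicator {\<omega> \<in> space M. trajectory X n \<omega> = l \<and> (\<forall>k<n. l ! k \<notin> T k \<omega>)} \<omega> \<partial>M)"
      by (intro nn_integral_cong) (auto split: split_indicator)
    also have "\<dots> = emeasure M {\<omega> \<in> space M. trajectory X n \<omega> = l \<and> (\<forall>k<n. l ! k \<notin> T k \<omega>)}"
      by (rule nn_integral_indicator) measurable
    also have "\<dots> = ?W l * emeasure M {\<omega> \<in> space M. trajectory X n \<omega> = l}"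
      using q by (simp add: emeasure_eq_measure prob_path_and_no_trap[OF mc field True]
          ennreal_mult' prod_ennreal prod_nonneg mult.commute)
    finally show ?thesis .
  next
    case False
    then have "\<And>\<omega>. trajectory X n \<omega> \<noteq> l" using length_trajectory by metis
    then show ?thesis by simp
  qed
  have "{\<omega> \<in> space M. \<forall>k<n. X k \<omega> \<notin> T k \<omega>} \<in> sets M"
    using hit by measurable
  then have "emeasure M {\<omega> \<in> space M. \<forall>k<n. X k \<omega> \<notin> T k \<omega>}
      = (\<integral>\<^sup>+ \<omega>. indicator {\<omega> \<in> space M. \<forall>k<n. X k \<omega> \<notin> T k \<omega>} \<omega> \<partial>M)"
    by simp
  also have "\<dots> = (\<integral>\<^sup>+ \<omega>. ?H (trajectory X n \<omega>) \<omega> \<partial>M)"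
    by (intro nn_integral_cong) (auto split: split_indicator)
  also have "\<dots> = (\<integral>\<^sup>+ l. ?W l * emeasure M {\<omega> \<in> space M. trajectory X n \<omega> = l} \<partial>count_space UNIV)"
    by (subst nn_integral_split_countable) (simp_all add: slice)
  also have "\<dots> = (\<integral>\<^sup>+ \<omega>. ?W (trajectory X n \<omega>) \<partial>M)"
    by (rule nn_integral_countable[symmetric]) measurable
  also have "\<dots> = (killed_op p q ^^ n) (\<lambda>_. 1) x"
    using nn_integral_killed_op_power[OF mc p, where n = n and q = q and f = "\<lambda>_. 1"] by simp
  finally show ?thesis .
qed

text \<open>
  Surviving forever is contained in surviving for \<open>n\<close> steps, so its probability bounds each of the
  iterates, and hence their infimum, from below.
\<close>

lemma non_trapping_imp_survival_pos:
  fixes X :: "nat \<Rightarrow> 'w \<Rightarrow> 's::countable"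
  assumes mc: "markov_chain (P x) X p x" and field: "annealed_field (P x) X T q"
    and p: "transition_probabilities p" and q: "\<And>x. q x \<le> 1"
    and nontrap: "trap_prob P X T x < 1"
  shows "0 < survival p q x"
proof -
  interpret prob_space "P x" using mc by (simp add: markov_chain_def)
  let ?M = "P x"
  have [measurable]: "\<And>n. X n \<in> measurable ?M (count_space UNIV)"
    using mc by (simp add: markov_chain_def)
  note [measurable] = measurable_annealed_field[OF prob_space_axioms field]
  have "{\<omega> \<in> space ?M. \<exists>n. X n \<omega> \<in> T n \<omega>} = {\<omega> \<in> space ?M. \<exists>n y. X n \<omega> = y \<and> y \<in> T n \<omega>}"
    by auto
  also have "\<dots> \<in> sets ?M"
    by measurable
  finally have meas: "{\<omega> \<in> space ?M. \<exists>n. X n \<omega> \<in> T n \<omega>} \<in> sets ?M" .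
  let ?S = "space ?M - {\<omega> \<in> space ?M. \<exists>n. X n \<omega> \<in> T n \<omega>}"
  have "prob ?S = 1 - trap_prob P X T x"
    using prob_compl[OF meas] by (simp add: trap_prob_def)
  then have "0 < emeasure ?M ?S"
    using nontrap by (simp add: emeasure_eq_measure)
  also have "emeasure ?M ?S \<le> survival p q x"
    unfolding survival_def
  proof (rule INF_greatest)
    fix n
    have "{\<omega> \<in> space ?M. \<forall>k<n. X k \<omega> \<notin> T k \<omega>}
        = {\<omega> \<in> space ?M. \<forall>k<n. \<forall>y. X k \<omega> = y \<longrightarrow> y \<notin> T k \<omega>}"
      by auto
    also have "\<dots> \<in> sets ?M"
      by measurable
    finally have "emeasure ?M ?S \<le> emeasure ?M {\<omega> \<in> space ?M. \<forall>k<n. X k \<omega> \<notin> T k \<omega>}"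
      by (intro emeasure_mono) auto
    then show "emeasure ?M ?S \<le> (killed_op p q ^^ n) (\<lambda>_. 1) x"
      by (simp add: emeasure_no_trap[OF mc field p q])
  qed
  finally show ?thesis .
qed

section \<open>Subharmonic functions along the chain\<close>

text \<open>
  The submartingale inequality for the process stopped on entering \<open>A\<close>, where the stopped part is
  bounded by \<open>c\<close>. In the step from \<open>n\<close> to \<open>n + 1\<close>, the paths that enter \<open>A\<close> at time \<open>n\<close> move to
  the first summand, and the Markov property applies to the others.
\<close>

lemma subharmonic_stopped:
  fixes X :: "nat \<Rightarrow> 'w \<Rightarrow> 's::countable" and f :: "'s \<Rightarrow> ennreal"
  assumes mc: "markov_chain M X p x" and p: "transition_probabilities p"
    and sub: "f \<le> transition_op p f" and low: "\<And>y. y \<in> A \<Longrightarrow> f y \<le> c"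
  shows "f x \<le> c * emeasure M {\<omega> \<in> space M. \<exists>k<n. X k \<omega> \<in> A}
             + (\<integral>\<^sup>+ \<omega>. indicator {\<omega>. \<forall>k<n. X k \<omega> \<notin> A} \<omega> * f (X n \<omega>) \<partial>M)"
proof (induction n)
  case 0
  then show ?case using nn_integral_start[OF mc, of f] by simp
next
  case (Suc n)
  interpret prob_space M using mc by (simp add: markov_chain_def)
  have [measurable]: "\<And>n. X n \<in> measurable M (count_space UNIV)"
    using mc by (simp add: markov_chain_def)
  let ?N = "\<lambda>n. {\<omega>. \<forall>k<n. X k \<omega> \<notin> A}"
  let ?H = "\<lambda>n. {\<omega> \<in> space M. \<exists>k<n. X k \<omega> \<in> A}"
  let ?D = "{\<omega> \<in> space M. (\<forall>k<n. X k \<omega> \<notin> A) \<and> X n \<omega> \<in> A}"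
  have "(\<integral>\<^sup>+ \<omega>. indicator (?N n) \<omega> * f (X n \<omega>) \<partial>M)
      \<le> (\<integral>\<^sup>+ \<omega>. c * indicator ?D \<omega> + indicator (?N (Suc n)) \<omega> * transition_op p f (X n \<omega>) \<partial>M)"
    using low sub
    by (intro nn_integral_mono) (auto simp: le_fun_def less_Suc_eq split: split_indicator)
  also have "\<dots> = c * emeasure M ?D
      + (\<integral>\<^sup>+ \<omega>. indicator (?N (Suc n)) \<omega> * transition_op p f (X n \<omega>) \<partial>M)"
    by (subst nn_integral_add) (auto simp: nn_integral_cmult)
  also have "(\<integral>\<^sup>+ \<omega>. indicator (?N (Suc n)) \<omega> * transition_op p f (X n \<omega>) \<partial>M)
      = (\<integral>\<^sup>+ \<omega>. indicator (?N (Suc n)) \<omega> * f (X (Suc n) \<omega>) \<partial>M)"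
    using nn_integral_markov_step[OF mc p, of "\<lambda>l. indicator {l. \<forall>k<Suc n. l ! k \<notin> A} l" n f]
    by (simp add: indicator_def less_Suc_eq_le)
  finally have step: "(\<integral>\<^sup>+ \<omega>. indicator (?N n) \<omega> * f (X n \<omega>) \<partial>M)
      \<le> c * emeasure M ?D + (\<integral>\<^sup>+ \<omega>. indicator (?N (Suc n)) \<omega> * f (X (Suc n) \<omega>) \<partial>M)" .
  have "emeasure M (?H n) + emeasure M ?D = emeasure M (?H n \<union> ?D)"
    by (rule plus_emeasure) auto
  also have "?H n \<union> ?D = ?H (Suc n)"
    by (auto simp: less_Suc_eq)
  finally have "c * emeasure M (?H n) + c * emeasure M ?D = c * emeasure M (?H (Suc n))"
    by (simp flip: distrib_left)
  then show ?case
    using order_trans[OF Suc.IH add_left_mono[OF step]] by (simp flip: add.assoc)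
qed

lemma subharmonic_le_escape:
  fixes X :: "nat \<Rightarrow> 'w \<Rightarrow> 's::countable" and f :: "'s \<Rightarrow> ennreal"
  assumes mc: "markov_chain M X p x" and p: "transition_probabilities p"
    and sub: "f \<le> transition_op p f" and low: "\<And>y. y \<in> A \<Longrightarrow> f y \<le> c"
    and bound: "\<And>y. f y \<le> 1"
  shows "f x \<le> c + emeasure M {\<omega> \<in> space M. \<forall>n. X n \<omega> \<notin> A}"
proof -
  interpret prob_space M using mc by (simp add: markov_chain_def)
  have [measurable]: "\<And>n. X n \<in> measurable M (count_space UNIV)"
    using mc by (simp add: markov_chain_def)
  let ?N = "\<lambda>n. {\<omega> \<in> space M. \<forall>k<n. X k \<omega> \<notin> A}"
  have "f x \<le> c + emeasure M (?N n)" for n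
  proof -
    have "(\<integral>\<^sup>+ \<omega>. indicator {\<omega>. \<forall>k<n. X k \<omega> \<notin> A} \<omega> * f (X n \<omega>) \<partial>M)
        \<le> (\<integral>\<^sup>+ \<omega>. indicator (?N n) \<omega> \<partial>M)"
      using bound by (intro nn_integral_mono) (auto split: split_indicator)
    also have "\<dots> = emeasure M (?N n)"
      by (rule nn_integral_indicator) measurable
    finally have "(\<integral>\<^sup>+ \<omega>. indicator {\<omega>. \<forall>k<n. X k \<omega> \<notin> A} \<omega> * f (X n \<omega>) \<partial>M)
        \<le> emeasure M (?N n)" .
    moreover have "c * emeasure M {\<omega> \<in> space M. \<exists>k<n. X k \<omega> \<in> A} \<le> c * 1"
      by (intro mult_left_mono emeasure_le_1) auto
    ultimately show ?thesis
      using subharmonic_stopped[OF mc p sub low, where n = n] by (fastforce intro: order_trans add_mono)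
  qed
  moreover have "(\<lambda>n. c + emeasure M (?N n)) \<longlonglongrightarrow> c + emeasure M (\<Inter>n. ?N n)"
    by (intro tendsto_add tendsto_const Lim_emeasure_decseq) (auto simp: monotone_def)
  moreover have "(\<Inter>n. ?N n) = {\<omega> \<in> space M. \<forall>n. X n \<omega> \<notin> A}"
    by auto
  ultimately show ?thesis
    by (intro Lim_bounded2[where N = 0]) auto
qed

text \<open>
  The inequality \<open>E[f (X n)] + E[u (X n)] \<le> E[f (X (n + 1))]\<close> telescopes, and \<open>E[f (X n)]\<close> stays
  between 0 and 1.
\<close>

lemma drift_sum_le:
  fixes X :: "nat \<Rightarrow> 'w \<Rightarrow> 's::countable" and f u :: "'s \<Rightarrow> ennreal"
  assumes mc: "markov_chain M X p x" and p: "transition_probabilities p"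
    and drift: "\<And>y. f y + u y \<le> transition_op p f y" and bound: "\<And>y. f y \<le> 1"
  shows "(\<Sum>n. \<integral>\<^sup>+ \<omega>. u (X n \<omega>) \<partial>M) \<le> 1"
proof -
  interpret prob_space M using mc by (simp add: markov_chain_def)
  have [measurable]: "\<And>n. X n \<in> measurable M (count_space UNIV)"
    using mc by (simp add: markov_chain_def)
  have "(\<Sum>n<N. \<integral>\<^sup>+ \<omega>. u (X n \<omega>) \<partial>M) \<le> (\<integral>\<^sup>+ \<omega>. f (X N \<omega>) \<partial>M)" for N
  proof (induction N)
    case (Suc N)
    have "(\<Sum>n<Suc N. \<integral>\<^sup>+ \<omega>. u (X n \<omega>) \<partial>M)
        \<le> (\<integral>\<^sup>+ \<omega>. f (X N \<omega>) \<partial>M) + (\<integral>\<^sup>+ \<omega>. u (X N \<omega>) \<partial>M)"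
      using Suc by (simp add: add_right_mono)
    also have "\<dots> = (\<integral>\<^sup>+ \<omega>. f (X N \<omega>) + u (X N \<omega>) \<partial>M)"
      by (rule nn_integral_add[symmetric]) auto
    also have "\<dots> \<le> (\<integral>\<^sup>+ \<omega>. transition_op p f (X N \<omega>) \<partial>M)"
      by (intro nn_integral_mono drift)
    also have "\<dots> = (\<integral>\<^sup>+ \<omega>. f (X (Suc N) \<omega>) \<partial>M)"
      using nn_integral_markov_step[OF mc p, of "\<lambda>_. 1" N f] by simp
    finally show ?case .
  qed simp
  moreover have "(\<integral>\<^sup>+ \<omega>. f (X N \<omega>) \<partial>M) \<le> 1" for N
    using nn_integral_mono[of M "\<lambda>\<omega>. f (X N \<omega>)" "\<lambda>_. 1"] bound by (simp add: emeasure_space_1)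
  ultimately show ?thesis
    by (intro suminf_le_const summableI) (blast intro: order_trans)
qed

text \<open>
  Green's function is the density of the expected number of visits, so
  summing \<open>u\<close> against it gives the expected total of \<open>u\<close> along the chain.
\<close>

lemma sum_greens_le:
  fixes X :: "nat \<Rightarrow> 'w \<Rightarrow> 's::countable" and u :: "'s \<Rightarrow> ennreal"
  assumes mc: "markov_chain (P x) X p x" and "finite F"
  shows "(\<Sum>y\<in>F. greens P X x y * u y) \<le> (\<Sum>n. \<integral>\<^sup>+ \<omega>. u (X n \<omega>) \<partial>P x)"
proof -
  interpret prob_space "P x" using mc by (simp add: markov_chain_def)
  have X: "\<And>n. X n \<in> measurable (P x) (count_space UNIV)"
    using mc by (simp add: markov_chain_def)
  have "(\<Sum>y\<in>F. greens P X x y * u y)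
      = (\<Sum>y\<in>F. \<Sum>n. u y * emeasure (P x) {\<omega> \<in> space (P x). X n \<omega> = y})"
    by (simp add: greens_def emeasure_eq_measure mult.commute)
  also have "\<dots> = (\<Sum>n. \<Sum>y\<in>F. u y * emeasure (P x) {\<omega> \<in> space (P x). X n \<omega> = y})"
    by (rule suminf_sum[symmetric]) simp
  also have "\<dots> \<le> (\<Sum>n. \<integral>\<^sup>+ \<omega>. u (X n \<omega>) \<partial>P x)"
  proof (intro suminf_le summableI)
    fix n
    have "(\<Sum>y\<in>F. u y * emeasure (P x) {\<omega> \<in> space (P x). X n \<omega> = y})
        = (\<integral>\<^sup>+ y. u y * emeasure (P x) {\<omega> \<in> space (P x). X n \<omega> = y} * indicator F y \<partial>count_space UNIV)"
      using \<open>finite F\<close> by (simp add: nn_integral_count_space_finite flip: nn_integral_count_space_indicator)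
    also have "\<dots> \<le> (\<integral>\<^sup>+ y. u y * emeasure (P x) {\<omega> \<in> space (P x). X n \<omega> = y} \<partial>count_space UNIV)"
      by (intro nn_integral_mono) (auto split: split_indicator)
    finally show "(\<Sum>y\<in>F. u y * emeasure (P x) {\<omega> \<in> space (P x). X n \<omega> = y})
        \<le> (\<integral>\<^sup>+ \<omega>. u (X n \<omega>) \<partial>P x)"
      using nn_integral_countable[OF X, of u] by simp
  qed
  finally show ?thesis .
qed

section \<open>The transient set\<close>

theorem theorem1p2:
  fixes p :: "'s::countable \<Rightarrow> 's \<Rightarrow> real"
    and q :: "'s \<Rightarrow> real"
    and P :: "'s \<Rightarrow> 'w measure"
    and X :: "nat \<Rightarrow> 'w \<Rightarrow> 's"
    and T :: "nat \<Rightarrow> 'w \<Rightarrow> 's set"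
    and x0 :: 's
  assumes "transition_probabilities p"
    and "\<And>x. 0 \<le> q x \<and> q x < 1"
    and "\<And>x. markov_chain (P x) X p x"
    and "\<And>x. annealed_field (P x) X T q"
    and "trap_prob P X T x0 < 1"
  shows "\<exists>A. transient_for P X A x0 \<and>
             (\<Sum>\<^sub>\<infinity>x\<in>UNIV - A. greens P X x0 x * ennreal (q x)) < \<infinity>"
proof -
  note p = assms(1) and mc = assms(3)
  have q: "\<And>x. 0 \<le> q x \<and> q x \<le> 1"
    using assms(2) less_imp_le by blast
  interpret prob_space "P x0" using mc[of x0] by (simp add: markov_chain_def)
  have [measurable]: "\<And>n. X n \<in> measurable (P x0) (count_space UNIV)"
    using mc[of x0] by (simp add: markov_chain_def)
  let ?h = "survival p q"
  have "0 < ?h x0"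
    using non_trapping_imp_survival_pos[OF mc assms(4) p _ assms(5)] q by blast
  moreover have "?h x0 < top"
    using survival_le_1[of p q x0] by (rule order_le_less_trans) simp
  ultimately obtain r where r: "?h x0 = ennreal r" "0 < r"
    by (cases "?h x0") auto
  define e where "e = r / 2"
  have e: "0 < e" "?h x0 = ennreal e + ennreal e"
    using r by (auto simp: e_def simp flip: ennreal_plus)
  define A where "A = {y. ?h y \<le> ennreal e}"
  have "transient_for P X A x0"
  proof -
    have "?h \<le> transition_op p ?h"
    proof (rule le_funI)
      fix y
      have "?h y \<le> ?h y + ennreal (q y) * ?h y" by simp
      also have "\<dots> \<le> transition_op p ?h y" by (rule survival_drift[OF p q])
      finally show "?h y \<le> transition_op p ?h y" .
    qed
    then have "ennreal e + ennreal e
        \<le> ennreal e + emeasure (P x0) {\<omega> \<in> space (P x0). \<forall>n. X n \<omega> \<notin> A}"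
      using subharmonic_le_escape[OF mc[of x0] p, of ?h A "ennreal e"] survival_le_1[of p q]
      by (auto simp: A_def e(2))
    then have "e \<le> prob {\<omega> \<in> space (P x0). \<forall>n. X n \<omega> \<notin> A}"
      using e(1) by (simp add: emeasure_eq_measure flip: ennreal_plus)
    moreover have "{\<omega> \<in> space (P x0). \<forall>n. X n \<omega> \<notin> A}
        = space (P x0) - {\<omega> \<in> space (P x0). \<exists>n. X n \<omega> \<in> A}"
      by auto
    moreover have "prob (space (P x0) - {\<omega> \<in> space (P x0). \<exists>n. X n \<omega> \<in> A})
        = 1 - prob {\<omega> \<in> space (P x0). \<exists>n. X n \<omega> \<in> A}"
      by (intro prob_compl) measurable
    ultimately show ?thesis
      using e(1) by (simp add: transient_for_def)
  qed
  moreover have "(\<Sum>\<^sub>\<infinity>x\<in>UNIV - A. greens P X x0 x * ennreal (q x)) \<le> ennreal (1 / e)"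
  proof (rule infsum_le_finite_sums)
    fix F assume F: "finite F" "F \<subseteq> UNIV - A"
    \<comment> \<open>Outside \<open>A\<close> the constant \<open>e\<close> is below \<open>h\<close>, and \<open>q h\<close> is the drift of \<open>h\<close>.\<close>
    have "ennreal e * (\<Sum>x\<in>F. greens P X x0 x * ennreal (q x))
        = (\<Sum>x\<in>F. greens P X x0 x * (ennreal (q x) * ennreal e))"
      by (simp add: sum_distrib_left mult_ac)
    also have "\<dots> \<le> (\<Sum>x\<in>F. greens P X x0 x * (ennreal (q x) * ?h x))"
      using F by (intro sum_mono mult_left_mono) (auto simp: A_def)
    also have "\<dots> \<le> (\<Sum>n. \<integral>\<^sup>+ \<omega>. ennreal (q (X n \<omega>)) * ?h (X n \<omega>) \<partial>P x0)"
      by (rule sum_greens_le[OF mc F(1)])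
    also have "\<dots> \<le> 1"
      using drift_sum_le[OF mc p survival_drift[OF p q] survival_le_1] .
    finally have "ennreal (1 / e) * (ennreal e * (\<Sum>x\<in>F. greens P X x0 x * ennreal (q x)))
        \<le> ennreal (1 / e) * 1"
      by (rule mult_left_mono) simp
    then show "(\<Sum>x\<in>F. greens P X x0 x * ennreal (q x)) \<le> ennreal (1 / e)"
      using e(1) by (simp flip: mult.assoc ennreal_mult)
  qed (rule nonneg_summable_on_complete, simp)
  ultimately show ?thesis
    using le_less_trans ennreal_less_top by (metis infinity_ennreal_def)
qed

end
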